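(* Let $k\in\mathbb{N}$, let $\mathcal{X}\subseteq\mathbb{R}^k$ be a convex set, let $\Theta\subseteq\mathbb{R}^d$ be open, and let $\lambda$ denote Lebesgue measure on $\mathbb{R}^k$. Let $\{P_\vartheta:\vartheta\in\Theta\}\subset\mathcal{W}_2(\mathcal{X})$ be a parametric family of probability measures with $P_\vartheta\ll\lambda$ for all $\vartheta\in\Theta$, with Lebesgue densities $p_\vartheta$. Assume that $\vartheta\mapsto p_\vartheta(x)$ is differentiable for any $x\in\mathcal{X}$ and that $p_\vartheta(x)>0$ for any $x\in\mathcal{X}$ and $\vartheta\in\Theta$. Fix $t_0\in\Theta$, and assume that for any $t,\vartheta\in\Theta$ there is a nonempty subset $\Phi_0(t,\vartheta)\subseteq\Phi(t,\vartheta)$ such that for every $\vartheta\in\Theta$: (i) for any sequence $t_n\to t_0$ there exist a sequence $\phi^\vartheta_{t_n}\in\Phi_0(t_n,\vartheta)$ and a fixed element $\phi^\vartheta_{t_0}\in\Phi_0(t_0,\vartheta)$ such that, as $n\to\infty$, $\phi^\vartheta_{t_n}(x)-\phi^\vartheta_{t_0}(x)\to0$ for $\lambda$-a.e. $x\in\mathcal{X}$; (ii) there exists $\delta>0$ such that, for all $i=1,\dots,d$, $$\int_{\mathcal{X}}\ \sup_{t,\tilde t\in B_\delta(t_0)}\ \sup_{\phi\in\Phi_0(t,\vartheta)}\Bigl|\phi(x)\,\frac{\partial}{\partial v_i}p_v(x)\Big|_{v=\tilde t}\Bigr|\,\mathrm{d}x<\infty.$$ Then, for any $\vartheta\in\Theta$,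 the function $t\mapsto W_2^2(P_t,P_\vartheta)$ is differentiable at $t_0$ with derivative $$\nabla_tW_2^2(P_t,P_\vartheta)\big|_{t=t_0}=\int_{\mathcal{X}}\phi^\vartheta_{t_0}(x)\,\nabla_tp_t(x)\big|_{t=t_0}\,\mathrm{d}x$$ for any $\phi^\vartheta_{t_0}\in\Phi_0(t_0,\vartheta)$.
   Context: $\mathcal{W}_2(\mathcal{X})$ is the set of probability measures on $\mathcal{X}$ with finite second moment, and $W_2^2(P,Q)=\inf_\pi\int_{\mathcal{X}^2}\|x-y\|^2\,\mathrm{d}\pi(x,y)$, the infimum over all couplings $\pi$ of $P$ and $Q$ on $\mathcal{X}\times\mathcal{X}$. For $t\in\Theta$, $\delta>0$: $B_\delta(t)=\{s\in\Theta:\|s-t\|\le\delta\}$. For $t,\vartheta\in\Theta$, $$\Phi(t,\vartheta)=\Bigl\{\phi\in L^1(P_t):W_2^2(P_t,P_\vartheta)=\int_{\mathcal{X}}\phi\,\mathrm{d}P_t+\int_{\mathcal{X}}\phi^c\,\mathrm{d}P_\vartheta\Bigr\},\qquad\phi^c(y)=\inf_{x\in\mathcal{X}}\bigl(\|x-y\|^2-\phi(x)\bigr),$$ is the set of solutions of the dual optimal transport problem; it is known to be nonempty. *)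

theory Defs
  imports "HOL-Probability.Probability"
begin

text \<open>
  A probability measure on \<open>X\<close> lives on the trace of the Borel sigma-algebra on \<open>X\<close>.
\<close>

definition W2_space :: "'a::euclidean_space set \<Rightarrow> 'a measure set" where
  "W2_space X = {\<mu>. prob_space \<mu> \<and> sets \<mu> = sets (restrict_space borel X) \<and>
                     (\<integral>\<^sup>+x. ennreal ((norm x)\<^sup>2) \<partial>\<mu>) < \<infinity>}"

definition couplings :: "'a measure \<Rightarrow> 'a measure \<Rightarrow> ('a \<times> 'a) measure set" where
  "couplings P Q = {\<pi>. sets \<pi> = sets (P \<Otimes>\<^sub>M Q) \<and> distr \<pi> P fst = P \<and> distr \<pi> Q snd = Q}"

text \<open>
  The infimum is taken in the extended nonnegative reals; it is finite for measures in
  \<^const>\<open>W2_space\<close>, so the conversion to a real number loses nothing there.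
\<close>

definition W2_sq :: "'a::euclidean_space measure \<Rightarrow> 'a measure \<Rightarrow> real" where
  "W2_sq P Q = enn2real (INF \<pi>\<in>couplings P Q. \<integral>\<^sup>+(x, y). ennreal ((norm (x - y))\<^sup>2) \<partial>\<pi>)"

text \<open>
  The c-transform can take the value \<open>-\<infinity>\<close>, hence the extended reals.
\<close>

definition c_transform :: "'a::euclidean_space set \<Rightarrow> ('a \<Rightarrow> real) \<Rightarrow> 'a \<Rightarrow> ereal" where
  "c_transform X \<phi> y = (INF x\<in>X. ereal ((norm (x - y))\<^sup>2 - \<phi> x))"

text \<open>
  On \<open>X\<close> the c-transform is bounded above by a function that is integrable with respect to \<open>Q\<close>,
  so its integral always exists in \<open>[-\<infinity>, \<infinity>)\<close>. The dual equation equates this integral with a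
  real number, which is why the c-transform is required to be finite almost everywhere and
  integrable here: a Bochner integral alone would default to 0 otherwise.
\<close>

definition dual_solutions ::
    "'a::euclidean_space set \<Rightarrow> 'a measure \<Rightarrow> 'a measure \<Rightarrow> ('a \<Rightarrow> real) set" where
  "dual_solutions X P Q = {\<phi>. integrable P \<phi> \<and>
     (AE y in Q. \<bar>c_transform X \<phi> y\<bar> \<noteq> \<infinity>) \<and>
     integrable Q (\<lambda>y. real_of_ereal (c_transform X \<phi> y)) \<and>
     W2_sq P Q = (\<integral>x. \<phi> x \<partial>P) + (\<integral>y. real_of_ereal (c_transform X \<phi> y) \<partial>Q)}"

text \<open>
  Only the values of \<open>f\<close> on \<open>X\<close> matter. The completed Lebesgue measure is used because a convex
  set \<open>X\<close> is always Lebesgue measurable but need not be Borel. Having such a density entails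
  absolute continuity with respect to Lebesgue measure.
\<close>

definition has_lebesgue_density ::
    "'a::euclidean_space set \<Rightarrow> 'a measure \<Rightarrow> ('a \<Rightarrow> real) \<Rightarrow> bool" where
  "has_lebesgue_density X \<mu> f \<longleftrightarrow>
     f \<in> borel_measurable (lebesgue_on X) \<and> (\<forall>x\<in>X. 0 \<le> f x) \<and>
     (\<forall>A\<in>sets \<mu>. emeasure \<mu> A = (\<integral>\<^sup>+x\<in>A. ennreal (f x) \<partial>lebesgue))"

definition partial_deriv :: "'d::finite \<Rightarrow> (real^'d \<Rightarrow> real) \<Rightarrow> real^'d \<Rightarrow> real" where
  "partial_deriv i f v = deriv (\<lambda>h. f (v + h *\<^sub>R axis i 1)) 0"

definition gradient :: "(real^'d::finite \<Rightarrow> real) \<Rightarrow> real^'d \<Rightarrow> real^'d" where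
  "gradient f v = (\<chi> i. partial_deriv i f v)"

definition param_ball :: "'b::real_normed_vector set \<Rightarrow> real \<Rightarrow> 'b \<Rightarrow> 'b set" where
  "param_ball \<Theta> \<delta> t = {s\<in>\<Theta>. norm (s - t) \<le> \<delta>}"

end

theory Submission
  imports Defs
begin

text \<open>
  Weak duality shows that a dual solution \<open>\<phi>\<close> for \<open>(P t, P \<theta>)\<close> acts as a subgradient:
  \<open>W2_sq (P s) (P \<theta>) - W2_sq (P t) (P \<theta>) \<ge> \<integral> \<phi> (p s - p t)\<close>. With \<open>t = t\<^sub>0\<close> this bounds the increment
  at \<open>t\<^sub>0\<close> from below by means of any \<open>\<phi> \<in> \<Phi>\<^sub>0 t\<^sub>0 \<theta>\<close>; with \<open>s = t\<^sub>0\<close> it bounds the increment from above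
  by means of \<open>\<phi>\<^sub>n \<in> \<Phi>\<^sub>0 t\<^sub>n \<theta>\<close>. Since \<open>\<phi>\<^sub>n\<close> converges to some \<open>\<psi> \<in> \<Phi>\<^sub>0 t\<^sub>0 \<theta>\<close>, dominated convergence
  makes both bounds linear up to \<open>o(norm (t\<^sub>n - t\<^sub>0))\<close>, and comparing opposite directions shows that
  the two linear parts agree.
\<close>

section \<open>Domination by a non-measurable function, and convex sets\<close>

text \<open>
  The dominating function need not be measurable: \<^const>\<open>nn_integral\<close> is a lower integral, so it
  still bounds the integral of the measurable function \<open>SUP n. \<bar>g n\<bar>\<close>.
\<close>

lemma dominated_convergence_zero:
  fixes g :: "nat \<Rightarrow> 'a \<Rightarrow> real" and D :: "'a \<Rightarrow> ennreal"
  assumes [measurable]: "\<And>n. g n \<in> borel_measurable M"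
    and bound: "\<And>n x. x \<in> space M \<Longrightarrow> ennreal \<bar>g n x\<bar> \<le> D x"
    and fin: "(\<integral>\<^sup>+x. D x \<partial>M) < \<infinity>"
    and lim: "AE x in M. (\<lambda>n. g n x) \<longlonglongrightarrow> 0"
  shows "(\<lambda>n. \<integral>x. g n x \<partial>M) \<longlonglongrightarrow> 0"
proof -
  define w where "w x = (SUP n. ennreal \<bar>g n x\<bar>)" for x
  have w_meas [measurable]: "w \<in> borel_measurable M"
    unfolding w_def by measurable
  have "(\<integral>\<^sup>+x. w x \<partial>M) \<le> (\<integral>\<^sup>+x. D x \<partial>M)"
    unfolding w_def by (intro nn_integral_mono SUP_least bound)
  then have w_fin: "(\<integral>\<^sup>+x. w x \<partial>M) < \<infinity>"
    using fin by (rule order_le_less_trans)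
  then have w_AE: "AE x in M. w x \<noteq> \<infinity>"
    by (intro nn_integral_noteq_infinite) auto
  have "(\<integral>\<^sup>+x. ennreal (enn2real (w x)) \<partial>M) = (\<integral>\<^sup>+x. w x \<partial>M)"
    using w_AE by (intro nn_integral_cong_AE) (auto simp: less_top[symmetric])
  then have "integrable M (\<lambda>x. enn2real (w x))"
    using w_fin by (intro integrableI_nonneg) auto
  moreover have "AE x in M. norm (g n x) \<le> enn2real (w x)" for n
    using w_AE
  proof eventually_elim
    case (elim x)
    have "ennreal \<bar>g n x\<bar> \<le> w x"
      unfolding w_def by (rule SUP_upper) simp
    then show ?case
      using elim by (metis abs_ge_zero enn2real_ennreal enn2real_mono infinity_ennreal_def
          less_top real_norm_def)
  qed
  ultimately have "(\<lambda>n. \<integral>x. g n x \<partial>M) \<longlonglongrightarrow> (\<integral>x. 0 \<partial>M)"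
    using lim by (intro integral_dominated_convergence[where w = "\<lambda>x. enn2real (w x)"]) auto
  then show ?thesis
    by simp
qed

text \<open>Only monotonicity of the lower integral enters, so \<open>D\<close> may again be
  non-measurable.\<close>

lemma integrable_dominated_nn:
  fixes g :: "'a \<Rightarrow> real" and D :: "'a \<Rightarrow> ennreal"
  assumes "g \<in> borel_measurable M"
    and "\<And>x. x \<in> space M \<Longrightarrow> ennreal \<bar>g x\<bar> \<le> D x"
    and "(\<integral>\<^sup>+x. D x \<partial>M) < \<infinity>"
  shows "integrable M g"
proof (rule integrableI_bounded)
  have "(\<integral>\<^sup>+x. ennreal (norm (g x)) \<partial>M) \<le> (\<integral>\<^sup>+x. D x \<partial>M)"
    using assms(2) by (intro nn_integral_mono) simp
  then show "(\<integral>\<^sup>+x. ennreal (norm (g x)) \<partial>M) < \<infinity>"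
    using assms(3) by (rule order_le_less_trans)
qed fact

text \<open>Bounded convex sets are Lebesgue measurable, and balls of integer radius exhaust
  \<open>S\<close>. This is what allows restricting \<open>lebesgue\<close> to a convex set that is
  not Borel.\<close>

lemma convex_in_sets_lebesgue:
  fixes S :: "'a::euclidean_space set"
  assumes "convex S"
  shows "S \<in> sets lebesgue"
proof -
  have "S \<inter> cball 0 (real n) \<in> sets lebesgue" for n
    using assms by (intro fmeasurableD measurable_convex) (auto intro: convex_Int bounded_Int)
  then have "(\<Union>n. S \<inter> cball 0 (real n)) \<in> sets lebesgue"
    by blast
  moreover have "(\<Union>n. S \<inter> cball 0 (real n)) = S"
    using real_arch_simple by auto
  ultimately show ?thesis
    by simp
qed

section \<open>Couplings and weak Kantorovich duality\<close>

lemma space_W2_space: "P \<in> W2_space X \<Longrightarrow> space P = X"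
  unfolding W2_space_def
  by (auto dest: sets_eq_imp_space_eq simp: space_restrict_space)

text \<open>The independent coupling shows that the infimum defining the transport cost runs over a
  nonempty set.\<close>

lemma pair_measure_in_couplings:
  assumes "prob_space P" "prob_space Q"
  shows "P \<Otimes>\<^sub>M Q \<in> couplings P Q"
proof -
  interpret P: prob_space P by fact
  interpret Q: prob_space Q by fact
  have "distr (P \<Otimes>\<^sub>M Q) Q snd = Q"
  proof (intro measure_eqI)
    fix A assume A: "A \<in> sets (distr (P \<Otimes>\<^sub>M Q) Q snd)"
    then have "snd -` A \<inter> space (P \<Otimes>\<^sub>M Q) = space P \<times> A"
      using sets.sets_into_space by (auto simp: space_pair_measure)
    with A show "emeasure (distr (P \<Otimes>\<^sub>M Q) Q snd) A = emeasure Q A"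
      by (simp add: emeasure_distr Q.emeasure_pair_measure_Times P.emeasure_space_1)
  qed simp
  then show ?thesis
    unfolding couplings_def using Q.distr_pair_fst by simp
qed

lemma nn_integral_coupling_fst:
  assumes "\<pi> \<in> couplings P Q" "f \<in> borel_measurable P"
  shows "(\<integral>\<^sup>+z. f (fst z) \<partial>\<pi>) = (\<integral>\<^sup>+x. f x \<partial>P)"
proof -
  have "fst \<in> measurable \<pi> P"
    using assms(1) unfolding couplings_def by (subst measurable_cong_sets[where N' = P]) auto
  then have "(\<integral>\<^sup>+x. f x \<partial>distr \<pi> P fst) = (\<integral>\<^sup>+z. f (fst z) \<partial>\<pi>)"
    using assms(2) by (simp add: nn_integral_distr)
  then show ?thesis
    using assms(1) unfolding couplings_def by simp
qed

lemma nn_integral_coupling_snd: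
  assumes "\<pi> \<in> couplings P Q" "f \<in> borel_measurable Q"
  shows "(\<integral>\<^sup>+z. f (snd z) \<partial>\<pi>) = (\<integral>\<^sup>+x. f x \<partial>Q)"
proof -
  have "snd \<in> measurable \<pi> Q"
    using assms(1) unfolding couplings_def by (subst measurable_cong_sets[where N' = Q]) auto
  then have "(\<integral>\<^sup>+x. f x \<partial>distr \<pi> Q snd) = (\<integral>\<^sup>+z. f (snd z) \<partial>\<pi>)"
    using assms(2) by (simp add: nn_integral_distr)
  then show ?thesis
    using assms(1) unfolding couplings_def by simp
qed

text \<open>The independent coupling has finite cost, since the squared distance is at most twice
  the sum of the squared norms and both second moments are finite. Finiteness makes
  \<open>enn2real\<close> in \<open>W2_sq\<close> lossless.\<close>

lemma W2_cost_finite: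
  fixes X :: "'a::euclidean_space set"
  assumes P: "P \<in> W2_space X" and Q: "Q \<in> W2_space X"
  shows "(INF \<pi>\<in>couplings P Q. \<integral>\<^sup>+(x, y). ennreal ((norm (x - y))\<^sup>2) \<partial>\<pi>) < \<infinity>"
proof -
  have sets: "sets P = sets (restrict_space borel X)" "sets Q = sets (restrict_space borel X)"
    using P Q by (auto simp: W2_space_def)
  have prob: "prob_space P" "prob_space Q"
    using P Q by (auto simp: W2_space_def)
  have sq [measurable]: "(\<lambda>x. ennreal (2 * (norm x)\<^sup>2)) \<in> borel_measurable P"
      "(\<lambda>x. ennreal (2 * (norm x)\<^sup>2)) \<in> borel_measurable Q"
    using sets by (auto simp: measurable_cong_sets[OF sets(1) refl]
        measurable_cong_sets[OF sets(2) refl] intro!: measurable_restrict_space1)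
  have n2: "(\<integral>\<^sup>+x. ennreal (2 * (norm x)\<^sup>2) \<partial>M) < \<infinity>" if "M \<in> W2_space X" for M
  proof -
    have [measurable]: "(\<lambda>x. (norm x)\<^sup>2) \<in> borel_measurable M"
      using that by (auto simp: W2_space_def cong: measurable_cong_sets
          intro!: measurable_restrict_space1)
    have "(\<integral>\<^sup>+x. ennreal (2 * (norm x)\<^sup>2) \<partial>M) = 2 * (\<integral>\<^sup>+x. ennreal ((norm x)\<^sup>2) \<partial>M)"
      by (subst nn_integral_cmult[symmetric]) (auto simp: ennreal_mult)
    also have "\<dots> < \<infinity>"
      using that by (auto simp: W2_space_def ennreal_mult_less_top)
    finally show ?thesis .
  qed
  have \<pi>: "P \<Otimes>\<^sub>M Q \<in> couplings P Q"
    using prob by (rule pair_measure_in_couplings)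
  have sq_diff: "(norm (x - y))\<^sup>2 \<le> 2 * (norm x)\<^sup>2 + 2 * (norm y)\<^sup>2" for x y :: 'a
  proof -
    have "(norm (x - y))\<^sup>2 \<le> (norm x + norm y)\<^sup>2"
      by (intro power_mono norm_triangle_ineq4) simp
    also have "\<dots> \<le> 2 * (norm x)\<^sup>2 + 2 * (norm y)\<^sup>2"
      using sum_squares_bound[of "norm x" "norm y"] by (simp add: power2_sum)
    finally show ?thesis .
  qed
  have "(INF \<pi>\<in>couplings P Q. \<integral>\<^sup>+(x, y). ennreal ((norm (x - y))\<^sup>2) \<partial>\<pi>)
      \<le> (\<integral>\<^sup>+(x, y). ennreal ((norm (x - y))\<^sup>2) \<partial>(P \<Otimes>\<^sub>M Q))"
    using \<pi> by (rule INF_lower)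
  also have "\<dots> \<le> (\<integral>\<^sup>+z. ennreal (2 * (norm (fst z))\<^sup>2) + ennreal (2 * (norm (snd z))\<^sup>2) \<partial>(P \<Otimes>\<^sub>M Q))"
    by (intro nn_integral_mono)
      (auto simp: split_beta sq_diff ennreal_plus[symmetric] simp del: ennreal_plus)
  also have "\<dots> = (\<integral>\<^sup>+z. ennreal (2 * (norm (fst z))\<^sup>2) \<partial>(P \<Otimes>\<^sub>M Q))
      + (\<integral>\<^sup>+z. ennreal (2 * (norm (snd z))\<^sup>2) \<partial>(P \<Otimes>\<^sub>M Q))"
    by (intro nn_integral_add measurable_compose[OF measurable_fst sq(1)]
        measurable_compose[OF measurable_snd sq(2)])
  also have "\<dots> = (\<integral>\<^sup>+x. ennreal (2 * (norm x)\<^sup>2) \<partial>P) + (\<integral>\<^sup>+y. ennreal (2 * (norm y)\<^sup>2) \<partial>Q)"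
    using nn_integral_coupling_fst[OF \<pi> sq(1)] nn_integral_coupling_snd[OF \<pi> sq(2)] by simp
  also have "\<dots> < \<infinity>"
    using n2[OF P] n2[OF Q] by simp
  finally show ?thesis .
qed

text \<open>\<open>ennreal\<close> truncates negative values to 0, so the right-hand side is the
  integral of the positive part, which dominates \<open>g\<close>. This brings integrands of varying
  sign into the comparison with a cost in \<open>ennreal\<close>.\<close>

lemma ennreal_integral_le_nn_integral:
  fixes g :: "'a \<Rightarrow> real"
  assumes "integrable M g"
  shows "ennreal (\<integral>x. g x \<partial>M) \<le> (\<integral>\<^sup>+x. ennreal (g x) \<partial>M)"
proof -
  have i: "integrable M (\<lambda>x. max 0 (g x))"
    using assms by simp
  have "ennreal (\<integral>x. g x \<partial>M) \<le> ennreal (\<integral>x. max 0 (g x) \<partial>M)"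
    using assms i by (intro ennreal_leI integral_mono) auto
  also have "\<dots> = (\<integral>\<^sup>+x. ennreal (max 0 (g x)) \<partial>M)"
    using i by (intro nn_integral_eq_integral[symmetric]) auto
  also have "\<dots> = (\<integral>\<^sup>+x. ennreal (g x) \<partial>M)"
    by (intro nn_integral_cong) (auto simp: max_def ennreal_neg)
  finally show ?thesis .
qed

text \<open>The pointwise inequality between \<open>\<phi>\<close>, its c-transform and the cost is
  integrated against an arbitrary coupling. No optimality of \<open>\<phi>\<close> is assumed, so
  the bound can be applied to a potential that is optimal for a different first marginal.\<close>

lemma W2_weak_duality:
  fixes X :: "'a::euclidean_space set"
  assumes P: "P \<in> W2_space X" and Q: "Q \<in> W2_space X"
    and \<phi>: "integrable P \<phi>"
    and fin: "AE y in Q. \<bar>c_transform X \<phi> y\<bar> \<noteq> \<infinity>"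
    and \<phi>c: "integrable Q (\<lambda>y. real_of_ereal (c_transform X \<phi> y))"
  shows "(\<integral>x. \<phi> x \<partial>P) + (\<integral>y. real_of_ereal (c_transform X \<phi> y) \<partial>Q) \<le> W2_sq P Q"
proof -
  define \<psi> where "\<psi> y = real_of_ereal (c_transform X \<phi> y)" for y
  have "ennreal ((\<integral>x. \<phi> x \<partial>P) + (\<integral>y. \<psi> y \<partial>Q)) \<le> (\<integral>\<^sup>+(x, y). ennreal ((norm (x - y))\<^sup>2) \<partial>\<pi>)"
    if \<pi>: "\<pi> \<in> couplings P Q" for \<pi>
  proof -
    have sets_\<pi>: "sets \<pi> = sets (P \<Otimes>\<^sub>M Q)"
      and d1: "distr \<pi> P fst = P" and d2: "distr \<pi> Q snd = Q"
      using \<pi> by (auto simp: couplings_def)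
    have m1: "fst \<in> measurable \<pi> P" and m2: "snd \<in> measurable \<pi> Q"
      by (auto simp: measurable_cong_sets[OF sets_\<pi> refl])
    have i1: "integrable \<pi> (\<lambda>z. \<phi> (fst z))"
      using integrable_distr[OF m1] \<phi> by (simp add: d1)
    have i2: "integrable \<pi> (\<lambda>z. \<psi> (snd z))"
      using integrable_distr[OF m2] \<phi>c by (simp add: d2 \<psi>_def)
    have e1: "(\<integral>x. \<phi> x \<partial>P) = (\<integral>z. \<phi> (fst z) \<partial>\<pi>)"
      using integral_distr[OF m1, of \<phi>] \<phi> by (simp add: d1)
    have e2: "(\<integral>y. \<psi> y \<partial>Q) = (\<integral>z. \<psi> (snd z) \<partial>\<pi>)"
      using integral_distr[OF m2, of \<psi>] borel_measurable_integrable[OF \<phi>c] unfolding \<psi>_def by (simp add: d2)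
    have "AE y in distr \<pi> Q snd. \<bar>c_transform X \<phi> y\<bar> \<noteq> \<infinity>"
      using fin unfolding d2 .
    then have fin\<pi>: "AE z in \<pi>. \<bar>c_transform X \<phi> (snd z)\<bar> \<noteq> \<infinity>"
      by (rule AE_distrD[OF m2])
    have space_\<pi>: "space \<pi> = X \<times> X"
      using sets_eq_imp_space_eq[OF sets_\<pi>] space_W2_space[OF P] space_W2_space[OF Q]
      by (simp add: space_pair_measure)
    have le: "AE z in \<pi>. \<phi> (fst z) + \<psi> (snd z) \<le> (norm (fst z - snd z))\<^sup>2"
      using fin\<pi> AE_space
    proof eventually_elim
      case (elim z)
      then have "fst z \<in> X"
        by (auto simp: space_\<pi>)
      then have "c_transform X \<phi> (snd z) \<le> ereal ((norm (fst z - snd z))\<^sup>2 - \<phi> (fst z))"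
        unfolding c_transform_def by (rule INF_lower)
      \<comment> \<open>Finiteness matters: \<open>real_of_ereal\<close> sends an infinite value to
        0, and with c-transform -infinity the bound could fail.\<close>
      then have "\<psi> (snd z) \<le> (norm (fst z - snd z))\<^sup>2 - \<phi> (fst z)"
        using elim unfolding \<psi>_def by (cases "c_transform X \<phi> (snd z)") auto
      then show ?case
        by simp
    qed
    have "ennreal ((\<integral>x. \<phi> x \<partial>P) + (\<integral>y. \<psi> y \<partial>Q)) = ennreal (\<integral>z. \<phi> (fst z) + \<psi> (snd z) \<partial>\<pi>)"
      using i1 i2 by (simp add: e1 e2)
    also have "\<dots> \<le> (\<integral>\<^sup>+z. ennreal (\<phi> (fst z) + \<psi> (snd z)) \<partial>\<pi>)"
      using i1 i2 by (intro ennreal_integral_le_nn_integral Bochner_Integration.integrable_add)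
    also have "\<dots> \<le> (\<integral>\<^sup>+(x, y). ennreal ((norm (x - y))\<^sup>2) \<partial>\<pi>)"
      using le by (intro nn_integral_mono_AE) (auto simp: split_beta intro: ennreal_leI)
    finally show ?thesis .
  qed
  then have "ennreal ((\<integral>x. \<phi> x \<partial>P) + (\<integral>y. \<psi> y \<partial>Q))
      \<le> (INF \<pi>\<in>couplings P Q. \<integral>\<^sup>+(x, y). ennreal ((norm (x - y))\<^sup>2) \<partial>\<pi>)" (is "_ \<le> ?I")
    by (rule INF_greatest)
  moreover have "?I = ennreal (W2_sq P Q)"
    using W2_cost_finite[OF P Q] by (simp add: W2_sq_def less_top)
  ultimately have "ennreal ((\<integral>x. \<phi> x \<partial>P) + (\<integral>y. \<psi> y \<partial>Q)) \<le> ennreal (W2_sq P Q)"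
    by simp
  \<comment> \<open>With a nonnegative right-hand side, \<open>ennreal\<close> can be removed even
    if the dual value on the left is negative and was truncated to 0.\<close>
  moreover have "0 \<le> W2_sq P Q"
    by (simp add: W2_sq_def)
  ultimately show ?thesis
    unfolding \<psi>_def using ennreal_le_iff by blast
qed

section \<open>Lebesgue densities and change of measure\<close>

text \<open>The identity is measurable from \<open>lebesgue_on X\<close> to the Borel trace on
  \<open>X\<close>, whether or not \<open>X\<close> itself is Borel.\<close>

lemma measurable_trace_borel_lebesgue_on:
  assumes "sets \<mu> = sets (restrict_space borel X)" "\<phi> \<in> borel_measurable \<mu>"
  shows "\<phi> \<in> borel_measurable (lebesgue_on X)"
proof -
  have "\<phi> \<in> borel_measurable (restrict_space borel X)"
    using assms measurable_cong_sets by blast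
  moreover have "(\<lambda>x. x) \<in> measurable (lebesgue_on X) (restrict_space borel X)"
    by (intro measurable_restrict_space3) (auto simp: measurable_completion)
  ultimately show ?thesis
    using measurable_compose by blast
qed

lemma measurable_id_density:
  assumes "sets \<mu> = sets (restrict_space borel X)"
  shows "(\<lambda>x. x) \<in> measurable (density (lebesgue_on X) f) \<mu>"
proof -
  have "(\<lambda>x. x) \<in> measurable (lebesgue_on X) (restrict_space borel X)"
    by (intro measurable_restrict_space3) (auto simp: measurable_completion)
  then show ?thesis
    using assms by (simp cong: measurable_cong_sets)
qed

text \<open>The density measure carries the completed sigma-algebra, in general finer than that of
  \<open>\<mu>\<close>, so the two measures cannot simply be equated. Pushing forward along the
  identity restricts it to the sets of \<open>\<mu>\<close>.\<close>

lemma has_lebesgue_density_distr: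
  assumes X: "X \<in> sets lebesgue" and \<mu>: "sets \<mu> = sets (restrict_space borel X)"
    and f: "has_lebesgue_density X \<mu> f"
  shows "\<mu> = distr (density (lebesgue_on X) f) \<mu> (\<lambda>x. x)"
proof (rule measure_eqI)
  note id = measurable_id_density[OF \<mu>, where f = f]
  fix A assume A: "A \<in> sets \<mu>"
  then have AX: "A \<subseteq> X"
    using \<mu> by (auto simp: sets_restrict_space)
  have space: "space (lebesgue_on X) = X"
    by (simp add: space_restrict_space)
  have AL: "A \<in> sets (lebesgue_on X)"
    using measurable_sets[OF id A] AX by (simp add: space Int_absorb2)
  have [measurable]: "f \<in> borel_measurable (lebesgue_on X)"
    using f by (simp add: has_lebesgue_density_def)
  have "emeasure (distr (density (lebesgue_on X) f) \<mu> (\<lambda>x. x)) A = emeasure (density (lebesgue_on X) f) A"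
    using A id AX by (simp add: emeasure_distr space Int_absorb2)
  also have "\<dots> = (\<integral>\<^sup>+x. ennreal (f x) * indicator A x \<partial>lebesgue_on X)"
    using AL by (simp add: emeasure_density)
  also have "\<dots> = (\<integral>\<^sup>+x. ennreal (f x) * indicator A x * indicator X x \<partial>lebesgue)"
    using X by (simp add: nn_integral_restrict_space)
  also have "\<dots> = (\<integral>\<^sup>+x. ennreal (f x) * indicator A x \<partial>lebesgue)"
    using AX by (intro nn_integral_cong) (auto simp: indicator_def)
  finally show "emeasure \<mu> A = emeasure (distr (density (lebesgue_on X) f) \<mu> (\<lambda>x. x)) A"
    using f A by (simp add: has_lebesgue_density_def)
qed simp

text \<open>Change of variables along the identity followed by the density formula. Used in both
  directions, the equivalence carries integrability from one member of the family to another through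
  \<open>lebesgue_on X\<close>.\<close>

lemma has_lebesgue_density_integral:
  fixes \<phi> :: "'a::euclidean_space \<Rightarrow> real"
  assumes X: "X \<in> sets lebesgue" and \<mu>: "sets \<mu> = sets (restrict_space borel X)"
    and f: "has_lebesgue_density X \<mu> f" and \<phi>: "\<phi> \<in> borel_measurable \<mu>"
  shows "integrable \<mu> \<phi> \<longleftrightarrow> integrable (lebesgue_on X) (\<lambda>x. \<phi> x * f x)"
    and "(\<integral>x. \<phi> x \<partial>\<mu>) = (\<integral>x. \<phi> x * f x \<partial>lebesgue_on X)"
proof -
  note id = measurable_id_density[OF \<mu>, where f = f]
  note \<phi>L = measurable_trace_borel_lebesgue_on[OF \<mu> \<phi>]
  have fm: "f \<in> borel_measurable (lebesgue_on X)" and f0: "AE x in lebesgue_on X. 0 \<le> f x"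
    using f by (auto simp: has_lebesgue_density_def space_restrict_space intro!: AE_I2)
  note D = has_lebesgue_density_distr[OF X \<mu> f]
  show "integrable \<mu> \<phi> \<longleftrightarrow> integrable (lebesgue_on X) (\<lambda>x. \<phi> x * f x)"
    using integrable_distr_eq[OF id \<phi>] integrable_density[OF \<phi>L fm f0] D
    by (simp add: mult.commute)
  show "(\<integral>x. \<phi> x \<partial>\<mu>) = (\<integral>x. \<phi> x * f x \<partial>lebesgue_on X)"
    using integral_distr[OF id \<phi>] integral_density[OF \<phi>L fm f0] D
    by (simp add: mult.commute)
qed

section \<open>Partial derivatives and first-order remainders\<close>

lemma has_derivative_along_axis:
  fixes f :: "real^'d \<Rightarrow> real"
  assumes "(f has_derivative f') (at (z + s *\<^sub>R axis i 1))"
  shows "((\<lambda>h. f (z + h *\<^sub>R axis i 1)) has_real_derivative f' (axis i 1)) (at s)"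
proof -
  have "((\<lambda>h. z + h *\<^sub>R axis i 1) has_derivative (\<lambda>h. h *\<^sub>R axis i 1)) (at s)"
    by (auto intro!: derivative_eq_intros)
  from has_derivative_compose[OF this assms]
  have "((\<lambda>h. f (z + h *\<^sub>R axis i 1)) has_derivative (\<lambda>h. f' (h *\<^sub>R axis i 1))) (at s)" .
  moreover have "f' (h *\<^sub>R axis i 1) = f' (axis i 1) * h" for h
    using linear_scale[OF has_derivative_linear[OF assms]] by simp
  ultimately show ?thesis
    by (simp add: has_field_derivative_def)
qed

lemma partial_deriv_eq_frechet:
  assumes "(f has_derivative f') (at v)"
  shows "partial_deriv i f v = f' (axis i 1)"
  unfolding partial_deriv_def
  using has_derivative_along_axis[of f f' v 0 i] assms by (intro DERIV_imp_deriv) simp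

text \<open>\<open>deriv\<close> is informative only where a derivative exists, which Frechet
  differentiability ensures. The parameter \<open>s\<close> is arbitrary because the mean value
  theorem needs derivatives along a whole segment.\<close>

lemma has_real_derivative_partial_deriv:
  fixes f :: "real^'d \<Rightarrow> real"
  assumes "f differentiable (at (z + s *\<^sub>R axis i 1))"
  shows "((\<lambda>h. f (z + h *\<^sub>R axis i 1)) has_real_derivative
    partial_deriv i f (z + s *\<^sub>R axis i 1)) (at s)"
  using assms has_derivative_along_axis partial_deriv_eq_frechet
  unfolding differentiable_def by metis

lemma has_derivative_partial_deriv:
  fixes f :: "real^'d \<Rightarrow> real"
  assumes "f differentiable (at v)"
  shows "(f has_derivative (\<lambda>h. \<Sum>i\<in>UNIV. h $ i * partial_deriv i f v)) (at v)"
proof -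
  obtain f' where f': "(f has_derivative f') (at v)"
    using assms unfolding differentiable_def by blast
  interpret f': linear f'
    using f' by (rule has_derivative_linear)
  have "f' h = (\<Sum>i\<in>UNIV. h $ i * partial_deriv i f v)" for h
  proof -
    have "f' h = f' (\<Sum>i\<in>UNIV. h $ i *\<^sub>R axis i 1)"
      using basis_expansion[of h] by (simp add: scalar_mult_eq_scaleR)
    also have "\<dots> = (\<Sum>i\<in>UNIV. h $ i * partial_deriv i f v)"
      by (simp add: f'.sum f'.scale partial_deriv_eq_frechet[OF f'])
    finally show ?thesis .
  qed
  with f' show ?thesis
    by (metis (no_types, lifting) has_derivative_transform ext)
qed

text \<open>The mean value theorem on the segment from \<open>z\<close> to the shifted point.
  Parametrizing it by the unit interval treats both signs of \<open>h\<close> and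
  \<open>h = 0\<close> alike; convexity keeps intermediate points in \<open>S\<close>.\<close>

lemma partial_deriv_mvt:
  fixes f :: "real^'d \<Rightarrow> real"
  assumes S: "convex S" and diff: "\<And>v. v \<in> S \<Longrightarrow> f differentiable (at v)"
    and z: "z \<in> S" "z + h *\<^sub>R axis i 1 \<in> S"
  shows "\<exists>\<xi>\<in>S. f (z + h *\<^sub>R axis i 1) - f z = h * partial_deriv i f \<xi>"
proof -
  have in_S: "z + s *\<^sub>R (h *\<^sub>R axis i 1) \<in> S" if "0 \<le> s" "s \<le> 1" for s
  proof -
    have "(1 - s) *\<^sub>R z + s *\<^sub>R (z + h *\<^sub>R axis i 1) \<in> S"
      using S z that by (intro convexD) auto
    then show ?thesis
      by (simp add: algebra_simps)
  qed
  have "((\<lambda>s. f (z + (s * h) *\<^sub>R axis i 1)) has_real_derivative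
      partial_deriv i f (z + (s * h) *\<^sub>R axis i 1) * h) (at s)"
    if "0 \<le> s" "s \<le> 1" for s
  proof (rule DERIV_chain2[where g = "\<lambda>s. s * h"])
    show "((\<lambda>k. f (z + k *\<^sub>R axis i 1)) has_real_derivative
        partial_deriv i f (z + (s * h) *\<^sub>R axis i 1)) (at (s * h))"
      using in_S[OF that] by (intro has_real_derivative_partial_deriv diff) simp
    show "((\<lambda>s. s * h) has_real_derivative h) (at s)"
      by (auto intro!: derivative_eq_intros)
  qed
  from MVT2[OF zero_less_one this] obtain s where s: "0 < s" "s < 1"
    and eq: "f (z + (1 * h) *\<^sub>R axis i 1) - f (z + (0 * h) *\<^sub>R axis i 1)
      = (1 - 0) * (partial_deriv i f (z + (s * h) *\<^sub>R axis i 1) * h)"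
    by blast
  show ?thesis
    using in_S[of s] s eq by (intro bexI[of _ "z + (s * h) *\<^sub>R axis i 1"]) auto
qed

text \<open>The remainder is divided by an upper bound \<open>r n\<close> of the distance, not by
  the distance itself: the intermediate points of a coordinatewise path may coincide with
  \<open>t\<close>.\<close>

lemma has_derivative_remainder_tendsto:
  fixes f :: "'a::real_normed_vector \<Rightarrow> real" and r :: "nat \<Rightarrow> real"
  assumes f: "(f has_derivative f') (at t)"
    and r: "\<And>n. 0 < r n" "r \<longlonglongrightarrow> 0" and a: "\<And>n. norm (a n - t) \<le> r n"
  shows "(\<lambda>n. (f (a n) - f t - f' (a n - t)) / r n) \<longlonglongrightarrow> 0"
proof (rule LIMSEQ_I)
  fix e :: real assume e: "0 < e"
  then obtain d where d: "0 < d"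
    and rem: "\<And>y. norm (y - t) < d \<Longrightarrow> norm (f y - f t - f' (y - t)) \<le> e / 2 * norm (y - t)"
    using f unfolding has_derivative_at_alt by (metis half_gt_zero)
  have "\<forall>\<^sub>F n in sequentially. r n < d"
    using r(2) d by (rule order_tendstoD)
  then obtain N where N: "\<And>n. n \<ge> N \<Longrightarrow> r n < d"
    unfolding eventually_sequentially by blast
  have "norm ((f (a n) - f t - f' (a n - t)) / r n - 0) < e" if "n \<ge> N" for n
  proof -
    have "norm (f (a n) - f t - f' (a n - t)) \<le> e / 2 * norm (a n - t)"
      using N[OF that] a[of n] by (intro rem) simp
    also have "\<dots> \<le> e / 2 * r n"
      using a e by (intro mult_left_mono) auto
    also have "\<dots> < e * r n"
      using e r(1) by simp
    finally show ?thesis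
      using r(1)[of n] by (simp add: divide_less_eq)
  qed
  then show "\<exists>N. \<forall>n\<ge>N. norm ((f (a n) - f t - f' (a n - t)) / r n - 0) < e"
    by blast
qed

section \<open>First-order expansion of integrals over a differentiable family\<close>

text \<open>This separates the differentiation from optimal transport. Later \<open>M\<close> is
  \<open>lebesgue_on X\<close>, and \<open>\<epsilon>\<close> is so small that the ball lies in the
  parameter set and in the region of domination.\<close>

locale differentiable_family =
  fixes M :: "'a measure" and p :: "real^'d \<Rightarrow> 'a \<Rightarrow> real" and t\<^sub>0 :: "real^'d" and \<epsilon> :: real
  assumes \<epsilon>_pos: "0 < \<epsilon>"
    and p_measurable: "\<And>v. v \<in> cball t\<^sub>0 \<epsilon> \<Longrightarrow> p v \<in> borel_measurable M"
    and p_differentiable: "\<And>v x. v \<in> cball t\<^sub>0 \<epsilon> \<Longrightarrow> x \<in> space M \<Longrightarrow> (\<lambda>v. p v x) differentiable (at v)"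
begin

abbreviation dp :: "'d \<Rightarrow> real^'d \<Rightarrow> 'a \<Rightarrow> real" where
  "dp i v x \<equiv> partial_deriv i (\<lambda>v. p v x) v"

text \<open>The derivative is a pointwise limit of difference quotients whose steps
  \<open>h n\<close> stay in the ball, where every \<open>p v\<close> is measurable.\<close>

lemma measurable_partial_deriv: "dp i t\<^sub>0 \<in> borel_measurable M"
proof (rule borel_measurable_LIMSEQ_real)
  define h where "h n = \<epsilon> / real (Suc n)" for n
  have h_pos: "0 < h n" and h_le: "h n \<le> \<epsilon>" for n
    using \<epsilon>_pos by (auto simp: h_def field_simps)
  have h_lim: "h \<longlonglongrightarrow> 0"
    unfolding h_def by (rule LIMSEQ_Suc[OF lim_const_over_n])
  show "(\<lambda>x. (p (t\<^sub>0 + h n *\<^sub>R axis i 1) x - p t\<^sub>0 x) / h n) \<in> borel_measurable M" for n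
    using h_pos[of n] h_le[of n] \<epsilon>_pos
    by (intro borel_measurable_divide borel_measurable_diff p_measurable borel_measurable_const)
      (auto simp: dist_norm)
  show "(\<lambda>n. (p (t\<^sub>0 + h n *\<^sub>R axis i 1) x - p t\<^sub>0 x) / h n) \<longlonglongrightarrow> dp i t\<^sub>0 x"
    if x: "x \<in> space M" for x
  proof -
    have "((\<lambda>s. p (t\<^sub>0 + s *\<^sub>R axis i 1) x) has_real_derivative dp i (t\<^sub>0 + 0 *\<^sub>R axis i 1) x) (at 0)"
      using \<epsilon>_pos x by (intro has_real_derivative_partial_deriv p_differentiable) auto
    then have "(\<lambda>s. (p (t\<^sub>0 + s *\<^sub>R axis i 1) x - p t\<^sub>0 x) / s) \<midarrow>0\<rightarrow> dp i t\<^sub>0 x"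
      by (simp add: DERIV_def)
    moreover have "filterlim h (at 0) sequentially"
      using h_lim h_pos by (auto simp: filterlim_at less_imp_neq[symmetric])
    ultimately show ?thesis
      by (rule filterlim_compose)
  qed
qed

text \<open>By the mean value theorem the increment is \<open>h\<close> times a partial derivative
  at some point of the ball, and \<open>\<bar>h\<bar> / r\<close> is at most 1. That point depends
  on \<open>x\<close>, so the bound must hold uniformly over the ball.\<close>

lemma axis_increment_le:
  assumes ab: "a \<in> cball t\<^sub>0 \<epsilon>" "b \<in> cball t\<^sub>0 \<epsilon>" and b: "b = a + h *\<^sub>R axis i 1"
    and r: "0 < r" "\<bar>h\<bar> \<le> r" and x: "x \<in> space M"
    and bound: "\<And>v. v \<in> cball t\<^sub>0 \<epsilon> \<Longrightarrow> ennreal \<bar>c * dp i v x\<bar> \<le> D"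
  shows "ennreal \<bar>c * (p b x - p a x) / r\<bar> \<le> D"
proof -
  obtain \<xi> where \<xi>: "\<xi> \<in> cball t\<^sub>0 \<epsilon>" and eq: "p b x - p a x = h * dp i \<xi> x"
    using partial_deriv_mvt[of "cball t\<^sub>0 \<epsilon>" "\<lambda>v. p v x" a h i] ab x p_differentiable
    unfolding b by auto
  have "\<bar>c * (p b x - p a x) / r\<bar> = \<bar>c * dp i \<xi> x\<bar> * (\<bar>h\<bar> / r)"
    using r by (simp add: eq abs_mult)
  also have "\<dots> \<le> \<bar>c * dp i \<xi> x\<bar> * 1"
    using r by (intro mult_left_mono) auto
  finally show ?thesis
    using bound[OF \<xi>] by (metis ennreal_leI mult.right_neutral order_trans)
qed

text \<open>One coordinate moves, while both endpoints may vary with \<open>n\<close>. Their Frechet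
  remainders at \<open>t\<^sub>0\<close> are small relative to \<open>r n\<close>, which gives
  pointwise convergence; the mean value bound supplies the domination.\<close>

lemma axis_increment_tendsto:
  fixes \<phi> :: "nat \<Rightarrow> 'a \<Rightarrow> real" and D :: "'a \<Rightarrow> ennreal"
  assumes \<phi>: "\<And>n. \<phi> n \<in> borel_measurable M" and \<psi>: "\<psi> \<in> borel_measurable M"
    and lim: "AE x in M. (\<lambda>n. \<phi> n x) \<longlonglongrightarrow> \<psi> x"
    and ab: "\<And>n. a n \<in> cball t\<^sub>0 \<epsilon>" "\<And>n. b n \<in> cball t\<^sub>0 \<epsilon>"
    and b: "\<And>n. b n = a n + h n *\<^sub>R axis i 1"
    and r: "\<And>n. 0 < r n" "r \<longlonglongrightarrow> 0" "\<And>n. \<bar>h n\<bar> \<le> r n"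
      "\<And>n. norm (a n - t\<^sub>0) \<le> r n" "\<And>n. norm (b n - t\<^sub>0) \<le> r n"
    and D: "(\<integral>\<^sup>+x. D x \<partial>M) < \<infinity>"
    and bound: "\<And>n x v. x \<in> space M \<Longrightarrow> v \<in> cball t\<^sub>0 \<epsilon> \<Longrightarrow> ennreal \<bar>\<phi> n x * dp i v x\<bar> \<le> D x"
      "\<And>x v. x \<in> space M \<Longrightarrow> v \<in> cball t\<^sub>0 \<epsilon> \<Longrightarrow> ennreal \<bar>\<psi> x * dp i v x\<bar> \<le> D x"
  shows "integrable M (\<lambda>x. \<phi> n x * (p (b n) x - p (a n) x))"
    and "(\<lambda>n. ((\<integral>x. \<phi> n x * (p (b n) x - p (a n) x) \<partial>M)
           - h n * (\<integral>x. \<psi> x * dp i t\<^sub>0 x \<partial>M)) / r n) \<longlonglongrightarrow> 0"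
proof -
  note [measurable] = \<phi> \<psi> measurable_partial_deriv p_measurable[OF ab(1)] p_measurable[OF ab(2)]
  have t0: "t\<^sub>0 \<in> cball t\<^sub>0 \<epsilon>"
    using \<epsilon>_pos by simp
  define A where "A n x = \<phi> n x * (p (b n) x - p (a n) x) / r n" for n x
  define B where "B x = \<psi> x * dp i t\<^sub>0 x" for x
  have [measurable]: "A n \<in> borel_measurable M" "B \<in> borel_measurable M" for n
    unfolding A_def B_def by measurable
  have A_le: "ennreal \<bar>A n x\<bar> \<le> D x" if "x \<in> space M" for n x
    unfolding A_def by (rule axis_increment_le[OF ab b r(1,3)]) (auto intro: that bound)
  have B_le: "ennreal \<bar>B x\<bar> \<le> D x" if "x \<in> space M" for x
    unfolding B_def using that t0 by (rule bound)
  have A_int: "integrable M (A n)" for n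
    using A_le D by (intro integrable_dominated_nn) auto
  have B_int: "integrable M B"
    using B_le D by (intro integrable_dominated_nn) auto
  have "integrable M (\<lambda>x. r n * A n x)"
    using A_int by simp
  then show "integrable M (\<lambda>x. \<phi> n x * (p (b n) x - p (a n) x))"
    using r(1)[of n] by (simp add: A_def)
  have hr: "\<bar>h n / r n\<bar> \<le> 1" for n
    using r(1)[of n] r(3)[of n] by simp
  \<comment> \<open>Halving makes \<open>D\<close> itself, rather than a sum of two copies, dominate
    the difference of two functions bounded by \<open>D\<close>.\<close>
  define g where "g n x = (A n x - h n / r n * B x) / 2" for n x
  have g_int: "2 * (\<integral>x. g n x \<partial>M) = ((\<integral>x. \<phi> n x * (p (b n) x - p (a n) x) \<partial>M)
      - h n * (\<integral>x. \<psi> x * dp i t\<^sub>0 x \<partial>M)) / r n" for n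
  proof -
    have "(\<integral>x. g n x \<partial>M) = ((\<integral>x. A n x \<partial>M) - h n / r n * (\<integral>x. B x \<partial>M)) / 2"
      unfolding g_def using A_int B_int by simp
    then show ?thesis
      by (simp add: A_def B_def diff_divide_distrib)
  qed
  have "(\<lambda>n. \<integral>x. g n x \<partial>M) \<longlonglongrightarrow> 0"
  proof (rule dominated_convergence_zero)
    show "g n \<in> borel_measurable M" for n
      unfolding g_def by measurable
    show "ennreal \<bar>g n x\<bar> \<le> D x" if x: "x \<in> space M" for n x
    proof -
      have "\<bar>h n / r n * B x\<bar> \<le> \<bar>B x\<bar>"
        using mult_right_mono[OF hr[of n] abs_ge_zero[of "B x"]] by (simp add: abs_mult)
      moreover have "\<bar>(u - v) / 2\<bar> \<le> max \<bar>u\<bar> \<bar>w\<bar>" if "\<bar>v\<bar> \<le> \<bar>w\<bar>" for u v w :: real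
        using that abs_triangle_ineq4[of u v] max.cobounded1[of "\<bar>u\<bar>" "\<bar>w\<bar>"]
          max.cobounded2[of "\<bar>w\<bar>" "\<bar>u\<bar>"] by simp
      ultimately have "\<bar>g n x\<bar> \<le> max \<bar>A n x\<bar> \<bar>B x\<bar>"
        unfolding g_def by blast
      then have "ennreal \<bar>g n x\<bar> \<le> ennreal (max \<bar>A n x\<bar> \<bar>B x\<bar>)"
        by (rule ennreal_leI)
      also have "\<dots> \<le> D x"
        using A_le[OF x] B_le[OF x] by (simp add: max_def)
      finally show ?thesis .
    qed
    show "AE x in M. (\<lambda>n. g n x) \<longlonglongrightarrow> 0"
      using lim AE_space
    proof eventually_elim
      case (elim x)
      define f' where "f' k = (\<Sum>j\<in>UNIV. k $ j * dp j t\<^sub>0 x)" for k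
      have f': "((\<lambda>v. p v x) has_derivative f') (at t\<^sub>0)"
        unfolding f'_def
        using p_differentiable[OF t0 elim(2)] by (rule has_derivative_partial_deriv)
      have lin: "f' (b n - t\<^sub>0) - f' (a n - t\<^sub>0) = h n * dp i t\<^sub>0 x" for n
      proof -
        have "f' (b n - t\<^sub>0) - f' (a n - t\<^sub>0) = f' (h n *\<^sub>R axis i 1)"
          using linear_diff[OF has_derivative_linear[OF f'], of "b n - t\<^sub>0" "a n - t\<^sub>0"]
          by (simp add: b)
        then show ?thesis
          using linear_scale[OF has_derivative_linear[OF f']] partial_deriv_eq_frechet[OF f']
          by simp
      qed
      \<comment> \<open>\<open>q n\<close> is the difference of the normalized Frechet remainders at
        \<open>b n\<close> and \<open>a n\<close>; by \<open>lin\<close> the linear parts leave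
        exactly the \<open>i\<close>-th partial derivative.\<close>
      define q where "q n = (p (b n) x - p (a n) x - h n * dp i t\<^sub>0 x) / r n" for n
      have "(\<lambda>n. (p (b n) x - p t\<^sub>0 x - f' (b n - t\<^sub>0)) / r n
          - (p (a n) x - p t\<^sub>0 x - f' (a n - t\<^sub>0)) / r n) \<longlonglongrightarrow> 0 - 0"
        using f' r by (intro tendsto_diff has_derivative_remainder_tendsto) auto
      moreover have "(p (b n) x - p t\<^sub>0 x - f' (b n - t\<^sub>0)) / r n
          - (p (a n) x - p t\<^sub>0 x - f' (a n - t\<^sub>0)) / r n = q n" for n
        using lin[of n] unfolding q_def by (simp add: diff_divide_distrib[symmetric])
      ultimately have q: "q \<longlonglongrightarrow> 0"
        by simp
      have "(\<lambda>n. \<phi> n x - \<psi> x) \<longlonglongrightarrow> 0"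
        using tendsto_diff[OF elim(1) tendsto_const[of "\<psi> x"]] by simp
      then have abs_lim: "(\<lambda>n. \<bar>\<phi> n x - \<psi> x\<bar>) \<longlonglongrightarrow> 0"
        by (rule tendsto_rabs_zero)
      \<comment> \<open>The ratio \<open>h n / r n\<close> is bounded but need not converge, so it
        is paired with the null sequence of differences of potentials.\<close>
      have "norm (h n / r n * (\<phi> n x - \<psi> x)) \<le> \<bar>\<phi> n x - \<psi> x\<bar>" for n
        using mult_right_mono[OF hr[of n] abs_ge_zero[of "\<phi> n x - \<psi> x"]]
        by (simp add: abs_mult)
      then have "(\<lambda>n. h n / r n * (\<phi> n x - \<psi> x)) \<longlonglongrightarrow> 0"
        by (intro Lim_null_comparison[OF always_eventually abs_lim] allI)
      \<comment> \<open>Twice \<open>g n x\<close> splits into the error of linearizing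
        \<open>p\<close>, weighted by \<open>\<phi> n x\<close>, and the error of replacing
        \<open>\<phi> n x\<close> by \<open>\<psi> x\<close> in the linear term.\<close>
      then have "(\<lambda>n. (\<phi> n x * q n + h n / r n * (\<phi> n x - \<psi> x) * dp i t\<^sub>0 x) / 2)
          \<longlonglongrightarrow> (\<psi> x * 0 + 0 * dp i t\<^sub>0 x) / 2"
        using q elim(1) by (intro tendsto_intros) auto
      moreover have "(\<phi> n x * q n + h n / r n * (\<phi> n x - \<psi> x) * dp i t\<^sub>0 x) / 2 = g n x" for n
        using r(1)[of n] unfolding g_def A_def B_def q_def by (simp add: field_simps)
      ultimately show ?case
        by simp
    qed
  qed fact
  then have "(\<lambda>n. 2 * (\<integral>x. g n x \<partial>M)) \<longlonglongrightarrow> 2 * 0"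
    by (intro tendsto_intros)
  then show "(\<lambda>n. ((\<integral>x. \<phi> n x * (p (b n) x - p (a n) x) \<partial>M)
      - h n * (\<integral>x. \<psi> x * dp i t\<^sub>0 x \<partial>M)) / r n) \<longlonglongrightarrow> 0"
    unfolding g_int by simp
qed

text \<open>
  The increment from \<open>t\<^sub>0\<close> to \<open>t n\<close> is telescoped over the coordinates because a sum of
  non-measurable functions \<open>D i\<close> with finite lower integrals can have infinite lower integral.
\<close>

lemma increment_tendsto:
  fixes \<phi> :: "nat \<Rightarrow> 'a \<Rightarrow> real" and D :: "'d \<Rightarrow> 'a \<Rightarrow> ennreal"
  assumes \<phi>: "\<And>n. \<phi> n \<in> borel_measurable M" and \<psi>: "\<psi> \<in> borel_measurable M"
    and lim: "AE x in M. (\<lambda>n. \<phi> n x) \<longlonglongrightarrow> \<psi> x"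
    and t: "\<And>n. t n \<in> cball t\<^sub>0 \<epsilon> - {t\<^sub>0}" "t \<longlonglongrightarrow> t\<^sub>0"
    and D: "\<And>i. (\<integral>\<^sup>+x. D i x \<partial>M) < \<infinity>"
    and bound: "\<And>i n x v. x \<in> space M \<Longrightarrow> v \<in> cball t\<^sub>0 \<epsilon> \<Longrightarrow> ennreal \<bar>\<phi> n x * dp i v x\<bar> \<le> D i x"
      "\<And>i x v. x \<in> space M \<Longrightarrow> v \<in> cball t\<^sub>0 \<epsilon> \<Longrightarrow> ennreal \<bar>\<psi> x * dp i v x\<bar> \<le> D i x"
  shows "integrable M (\<lambda>x. \<phi> n x * (p (t n) x - p t\<^sub>0 x))"
    and "(\<lambda>n. ((\<integral>x. \<phi> n x * (p (t n) x - p t\<^sub>0 x) \<partial>M)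
           - (\<Sum>i\<in>UNIV. (t n - t\<^sub>0) $ i * (\<integral>x. \<psi> x * dp i t\<^sub>0 x \<partial>M))) / norm (t n - t\<^sub>0)) \<longlonglongrightarrow> 0"
proof -
  \<comment> \<open>\<open>z S n\<close> takes the coordinates in \<open>S\<close> from
    \<open>t n\<close> and the others from \<open>t\<^sub>0\<close>. Enlarging \<open>S\<close> from
    the empty set to \<open>UNIV\<close> gives a path of axis-parallel moves that never leaves
    distance \<open>r n\<close> from \<open>t\<^sub>0\<close>.\<close>
  define z where "z S n = (\<chi> j. if j \<in> S then t n $ j else t\<^sub>0 $ j)" for S n
  define r where "r n = norm (t n - t\<^sub>0)" for n
  have r: "0 < r n" "r n \<le> \<epsilon>" for n
    using t(1)[of n] by (auto simp: r_def dist_norm norm_minus_commute)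
  have r_lim: "r \<longlonglongrightarrow> 0"
    unfolding r_def using tendsto_norm[OF tendsto_diff[OF t(2) tendsto_const[of t\<^sub>0]]] by simp
  have z_le: "norm (z S n - t\<^sub>0) \<le> r n" for S n
    unfolding r_def by (rule norm_le_componentwise_cart) (simp add: z_def)
  then have z_in: "z S n \<in> cball t\<^sub>0 \<epsilon>" for S n
    using order_trans[OF z_le r(2)] by (simp add: dist_norm norm_minus_commute)
  have h_le: "\<bar>(t n - t\<^sub>0) $ i\<bar> \<le> r n" for i n
    unfolding r_def by (rule component_le_norm_cart)
  \<comment> \<open>Integrability is part of the induction because the integral of the telescoped
    increment can be split only then. The scale \<open>r n\<close> stays the same in all steps, so
    the errors add.\<close>
  have claim: "(\<forall>n. integrable M (\<lambda>x. \<phi> n x * (p (z S n) x - p t\<^sub>0 x))) \<and>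
     (\<lambda>n. ((\<integral>x. \<phi> n x * (p (z S n) x - p t\<^sub>0 x) \<partial>M)
           - (\<Sum>i\<in>S. (t n - t\<^sub>0) $ i * (\<integral>x. \<psi> x * dp i t\<^sub>0 x \<partial>M))) / r n) \<longlonglongrightarrow> 0"
    if "finite S" for S
    using that
  proof induction
    case empty
    have "z {} n = t\<^sub>0" for n
      by (simp add: z_def vec_eq_iff)
    then show ?case
      by simp
  next
    case (insert i S)
    have step: "z (insert i S) n = z S n + ((t n - t\<^sub>0) $ i) *\<^sub>R axis i 1" for n
      using insert(2) by (auto simp: z_def vec_eq_iff axis_def)
    note inc = axis_increment_tendsto[OF \<phi> \<psi> lim z_in z_in step r(1) r_lim h_le z_le z_le D bound]
    have split: "\<phi> n x * (p (z (insert i S) n) x - p t\<^sub>0 x) = \<phi> n x * (p (z S n) x - p t\<^sub>0 x)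
        + \<phi> n x * (p (z (insert i S) n) x - p (z S n) x)" for n x
      by (simp add: algebra_simps)
    have int: "integrable M (\<lambda>x. \<phi> n x * (p (z S n) x - p t\<^sub>0 x))"
        "integrable M (\<lambda>x. \<phi> n x * (p (z (insert i S) n) x - p (z S n) x))" for n
      using insert(3) inc(1) by auto
    have eq: "((\<integral>x. \<phi> n x * (p (z (insert i S) n) x - p t\<^sub>0 x) \<partial>M)
        - (\<Sum>j\<in>insert i S. (t n - t\<^sub>0) $ j * (\<integral>x. \<psi> x * dp j t\<^sub>0 x \<partial>M))) / r n
      = ((\<integral>x. \<phi> n x * (p (z S n) x - p t\<^sub>0 x) \<partial>M)
          - (\<Sum>j\<in>S. (t n - t\<^sub>0) $ j * (\<integral>x. \<psi> x * dp j t\<^sub>0 x \<partial>M))) / r n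
        + ((\<integral>x. \<phi> n x * (p (z (insert i S) n) x - p (z S n) x) \<partial>M)
          - (t n - t\<^sub>0) $ i * (\<integral>x. \<psi> x * dp i t\<^sub>0 x \<partial>M)) / r n" for n
      unfolding split Bochner_Integration.integral_add[OF int]
      using insert(1,2) by (simp add: add_divide_distrib[symmetric])
    have "(\<lambda>n. ((\<integral>x. \<phi> n x * (p (z (insert i S) n) x - p t\<^sub>0 x) \<partial>M)
        - (\<Sum>j\<in>insert i S. (t n - t\<^sub>0) $ j * (\<integral>x. \<psi> x * dp j t\<^sub>0 x \<partial>M))) / r n) \<longlonglongrightarrow> 0 + 0"
      unfolding eq using insert(3) by (intro tendsto_add inc(2)) auto
    moreover have "integrable M (\<lambda>x. \<phi> n x * (p (z (insert i S) n) x - p t\<^sub>0 x))" for n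
      unfolding split by (intro Bochner_Integration.integrable_add int)
    ultimately show ?case
      by simp
  qed
  have z_UNIV: "z UNIV n = t n" for n
    by (simp add: z_def vec_eq_iff)
  show "integrable M (\<lambda>x. \<phi> n x * (p (t n) x - p t\<^sub>0 x))"
    using claim[of UNIV] by (simp add: z_UNIV)
  show "(\<lambda>n. ((\<integral>x. \<phi> n x * (p (t n) x - p t\<^sub>0 x) \<partial>M)
      - (\<Sum>i\<in>UNIV. (t n - t\<^sub>0) $ i * (\<integral>x. \<psi> x * dp i t\<^sub>0 x \<partial>M))) / norm (t n - t\<^sub>0)) \<longlonglongrightarrow> 0"
    using claim[of UNIV] by (simp add: z_UNIV r_def)
qed

end

section \<open>Differentiability from one-sided linear bounds along sequences\<close>

text \<open>
  The vector \<open>K\<close> of the upper bound may depend on the sequence. Applying the upper bound to \<open>t\<close>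
  interleaved with its reflection \<open>2t\<^sub>0 - t\<close> gives one \<open>K\<close> for both, and the lower bound along both
  forces \<open>(t n - t\<^sub>0) \<bullet> (K - L) = o(norm (t n - t\<^sub>0))\<close>.
\<close>

lemma gderiv_squeeze:
  fixes f :: "'a::real_inner \<Rightarrow> real"
  assumes \<epsilon>: "0 < \<epsilon>"
    and lower: "\<And>t. (\<And>n::nat. t n \<in> cball t\<^sub>0 \<epsilon> - {t\<^sub>0}) \<Longrightarrow> t \<longlonglongrightarrow> t\<^sub>0 \<Longrightarrow>
      \<exists>e. e \<longlonglongrightarrow> 0 \<and> (\<forall>n. f (t n) - f t\<^sub>0 \<ge> (t n - t\<^sub>0) \<bullet> L - e n * norm (t n - t\<^sub>0))"
    and upper: "\<And>t. (\<And>n::nat. t n \<in> cball t\<^sub>0 \<epsilon> - {t\<^sub>0}) \<Longrightarrow> t \<longlonglongrightarrow> t\<^sub>0 \<Longrightarrow>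
      \<exists>K. \<exists>e. e \<longlonglongrightarrow> 0 \<and> (\<forall>n. f (t n) - f t\<^sub>0 \<le> (t n - t\<^sub>0) \<bullet> K + e n * norm (t n - t\<^sub>0))"
  shows "GDERIV f t\<^sub>0 :> L"
proof -
  have "(\<lambda>n. norm (f (t n) - f t\<^sub>0 - (t n - t\<^sub>0) \<bullet> L) / norm (t n - t\<^sub>0)) \<longlonglongrightarrow> 0"
    if t: "\<And>n::nat. t n \<in> cball t\<^sub>0 \<epsilon> - {t\<^sub>0}" "t \<longlonglongrightarrow> t\<^sub>0" for t
  proof -
    define \<sigma> :: "nat \<Rightarrow> real" where "\<sigma> n = (if even n then 1 else -1)" for n
    define s where "s n = t\<^sub>0 + \<sigma> n *\<^sub>R (t (n div 2) - t\<^sub>0)" for n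
    have s_diff: "s n - t\<^sub>0 = \<sigma> n *\<^sub>R (t (n div 2) - t\<^sub>0)" for n
      by (simp add: s_def)
    have s_norm: "norm (s n - t\<^sub>0) = norm (t (n div 2) - t\<^sub>0)" for n
      by (simp add: s_diff \<sigma>_def)
    have s_in: "s n \<in> cball t\<^sub>0 \<epsilon> - {t\<^sub>0}" for n
      using t(1)[of "n div 2"] s_norm[of n] by (auto simp: dist_norm norm_minus_commute)
    have "filterlim (\<lambda>n::nat. n div 2) sequentially sequentially"
      by (rule filterlim_at_top_div_const_nat) simp
    with t(2) have "(\<lambda>n. t (n div 2)) \<longlonglongrightarrow> t\<^sub>0"
      by (rule filterlim_compose)
    then have "(\<lambda>n. norm (t (n div 2) - t\<^sub>0)) \<longlonglongrightarrow> 0"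
      by (intro tendsto_norm_zero LIM_zero)
    then have "(\<lambda>n. s n - t\<^sub>0) \<longlonglongrightarrow> 0"
      by (subst tendsto_norm_zero_iff[symmetric]) (simp add: s_norm)
    then have s_lim: "s \<longlonglongrightarrow> t\<^sub>0"
      by (rule LIM_zero_cancel)
    obtain e where e: "e \<longlonglongrightarrow> 0"
      and lo: "\<And>n. f (s n) - f t\<^sub>0 \<ge> (s n - t\<^sub>0) \<bullet> L - e n * norm (s n - t\<^sub>0)"
      using lower[OF s_in s_lim] by blast
    obtain K e' where e': "e' \<longlonglongrightarrow> 0"
      and up: "\<And>n. f (s n) - f t\<^sub>0 \<le> (s n - t\<^sub>0) \<bullet> K + e' n * norm (s n - t\<^sub>0)"
      using upper[OF s_in s_lim] by blast
    \<comment> \<open>Even indices give the errors at \<open>t n\<close>, odd ones those at its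
      reflection.\<close>
    define b where "b n = \<bar>e (2 * n)\<bar> + \<bar>e' (2 * n)\<bar> + \<bar>e (Suc (2 * n))\<bar> + \<bar>e' (Suc (2 * n))\<bar>" for n
    have sub: "(\<lambda>n. u (2 * n)) \<longlonglongrightarrow> 0" "(\<lambda>n. u (Suc (2 * n))) \<longlonglongrightarrow> 0"
      if "u \<longlonglongrightarrow> 0" for u :: "nat \<Rightarrow> real"
      using LIMSEQ_subseq_LIMSEQ[OF that, of "\<lambda>n. 2 * n"]
        LIMSEQ_subseq_LIMSEQ[OF that, of "\<lambda>n. Suc (2 * n)"]
      by (auto simp: strict_mono_def o_def)
    have "b \<longlonglongrightarrow> \<bar>0\<bar> + \<bar>0\<bar> + \<bar>0\<bar> + \<bar>0\<bar>"
      unfolding b_def by (intro tendsto_intros sub e e')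
    then have b_lim: "b \<longlonglongrightarrow> 0"
      by simp
    have "norm (f (t n) - f t\<^sub>0 - (t n - t\<^sub>0) \<bullet> L) / norm (t n - t\<^sub>0) \<le> b n" for n
    proof -
      define N where "N = norm (t n - t\<^sub>0)"
      have N: "0 < N"
        using t(1)[of n] by (simp add: N_def)
      have s2: "s (2 * n) - t\<^sub>0 = t n - t\<^sub>0" "s (Suc (2 * n)) - t\<^sub>0 = - (t n - t\<^sub>0)" "s (2 * n) = t n"
        by (simp_all add: s_def \<sigma>_def)
      have lo0: "f (t n) - f t\<^sub>0 \<ge> (t n - t\<^sub>0) \<bullet> L - e (2 * n) * N"
        and up0: "f (t n) - f t\<^sub>0 \<le> (t n - t\<^sub>0) \<bullet> K + e' (2 * n) * N"
        and lo1: "f (s (Suc (2 * n))) - f t\<^sub>0 \<ge> - ((t n - t\<^sub>0) \<bullet> L) - e (Suc (2 * n)) * N"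
        and up1: "f (s (Suc (2 * n))) - f t\<^sub>0 \<le> - ((t n - t\<^sub>0) \<bullet> K) + e' (Suc (2 * n)) * N"
        using lo[of "2 * n"] up[of "2 * n"] lo[of "Suc (2 * n)"] up[of "Suc (2 * n)"]
        unfolding s2 inner_minus_left norm_minus_cancel N_def by auto
      have abs: "u * N \<le> \<bar>u\<bar> * N" "0 \<le> \<bar>u\<bar> * N" for u
        using N by (auto intro: mult_right_mono)
      \<comment> \<open>One side is \<open>lo0\<close>. For the other, \<open>lo1\<close> and
        \<open>up1\<close> at the reflected point bound \<open>(t n - t\<^sub>0) \<bullet> K\<close>
        by \<open>(t n - t\<^sub>0) \<bullet> L\<close> plus errors, and this is inserted into
        \<open>up0\<close>.\<close>
      have "\<bar>f (t n) - f t\<^sub>0 - (t n - t\<^sub>0) \<bullet> L\<bar> \<le> b n * N"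
        using lo0 up0 lo1 up1 abs[of "e (2 * n)"] abs[of "e' (2 * n)"] abs[of "e (Suc (2 * n))"]
          abs[of "e' (Suc (2 * n))"]
        unfolding b_def distrib_right by linarith
      then show ?thesis
        using N by (simp add: N_def[symmetric] divide_le_eq)
    qed
    then show ?thesis
      by (intro tendsto_sandwich[OF _ _ tendsto_const b_lim]) auto
  qed
  then have "((\<lambda>y. norm (f y - f t\<^sub>0 - (y - t\<^sub>0) \<bullet> L) / norm (y - t\<^sub>0)) \<longlongrightarrow> 0)
      (at t\<^sub>0 within cball t\<^sub>0 \<epsilon>)"
    unfolding tendsto_at_iff_sequentially o_def by blast
  moreover have "at t\<^sub>0 within cball t\<^sub>0 \<epsilon> = at t\<^sub>0"
    using \<epsilon> by (meson at_within_interior ball_subset_cball centre_in_ball interiorI open_ball)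
  ultimately show ?thesis
    unfolding gderiv_def has_derivative_iff_norm
    by (simp add: bounded_linear_inner_left)
qed

section \<open>Subgradient inequality and the derivative of the squared distance\<close>

text \<open>Duality is an equality at \<open>P\<close>, where \<open>\<phi>\<close> is optimal, and
  an inequality at \<open>P'\<close>. The c-transform term depends only on \<open>\<phi>\<close> and
  \<open>Q\<close> and cancels.\<close>

lemma W2_sq_diff_ge:
  fixes X :: "'a::euclidean_space set"
  assumes X: "X \<in> sets lebesgue"
    and W: "P \<in> W2_space X" "P' \<in> W2_space X" "Q \<in> W2_space X"
    and dens: "has_lebesgue_density X P f" "has_lebesgue_density X P' f'"
    and \<phi>: "\<phi> \<in> dual_solutions X P Q"
    and int: "integrable (lebesgue_on X) (\<lambda>x. \<phi> x * (f' x - f x))"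
  shows "(\<integral>x. \<phi> x * (f' x - f x) \<partial>lebesgue_on X) \<le> W2_sq P' Q - W2_sq P Q"
proof -
  have sets: "sets P = sets (restrict_space borel X)" "sets P' = sets (restrict_space borel X)"
    using W by (auto simp: W2_space_def)
  have \<phi>P: "integrable P \<phi>"
    and fin: "AE y in Q. \<bar>c_transform X \<phi> y\<bar> \<noteq> \<infinity>"
    and \<phi>c: "integrable Q (\<lambda>y. real_of_ereal (c_transform X \<phi> y))"
    and eq: "W2_sq P Q = (\<integral>x. \<phi> x \<partial>P) + (\<integral>y. real_of_ereal (c_transform X \<phi> y) \<partial>Q)"
    using \<phi> by (auto simp: dual_solutions_def)
  have meas: "\<phi> \<in> borel_measurable P"
    using \<phi>P by (rule borel_measurable_integrable)
  then have meas': "\<phi> \<in> borel_measurable P'"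
    using sets measurable_cong_sets by blast
  note int_P = has_lebesgue_density_integral[OF X sets(1) dens(1) meas]
  note int_P' = has_lebesgue_density_integral[OF X sets(2) dens(2) meas']
  have f: "integrable (lebesgue_on X) (\<lambda>x. \<phi> x * f x)"
    using \<phi>P int_P(1) by blast
  \<comment> \<open>Integrability of \<open>\<phi>\<close> under \<open>P'\<close> is not given; it
    follows from that under \<open>P\<close> and the assumed integrability against the difference of
    densities.\<close>
  have split: "\<phi> x * f' x = \<phi> x * f x + \<phi> x * (f' x - f x)" for x
    by (simp add: algebra_simps)
  have f': "integrable (lebesgue_on X) (\<lambda>x. \<phi> x * f' x)"
    unfolding split using f int by (rule Bochner_Integration.integrable_add)
  then have "integrable P' \<phi>"
    using int_P'(1) by blast
  from W2_weak_duality[OF W(2,3) this fin \<phi>c] have "(\<integral>x. \<phi> x \<partial>P') - (\<integral>x. \<phi> x \<partial>P) \<le> W2_sq P' Q - W2_sq P Q"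
    using eq by simp
  moreover have "(\<integral>x. \<phi> x \<partial>P') - (\<integral>x. \<phi> x \<partial>P) = (\<integral>x. \<phi> x * (f' x - f x) \<partial>lebesgue_on X)"
    unfolding int_P(2) int_P'(2) using f f' by (simp add: right_diff_distrib)
  ultimately show ?thesis
    by simp
qed

theorem theorem4:
  fixes X :: "(real^'k) set"
    and \<Theta> :: "(real^'d) set"
    and P :: "real^'d \<Rightarrow> (real^'k) measure"
    and p :: "real^'d \<Rightarrow> real^'k \<Rightarrow> real"
    and \<Phi>\<^sub>0 :: "real^'d \<Rightarrow> real^'d \<Rightarrow> (real^'k \<Rightarrow> real) set"
    and t\<^sub>0 :: "real^'d"
  assumes "convex X"
    and "open \<Theta>"
    and "\<And>\<theta>. \<theta> \<in> \<Theta> \<Longrightarrow> P \<theta> \<in> W2_space X"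
    and "\<And>\<theta>. \<theta> \<in> \<Theta> \<Longrightarrow> has_lebesgue_density X (P \<theta>) (p \<theta>)"
    and "\<And>x \<theta>. x \<in> X \<Longrightarrow> \<theta> \<in> \<Theta> \<Longrightarrow> (\<lambda>v. p v x) differentiable (at \<theta>)"
    and "\<And>x \<theta>. x \<in> X \<Longrightarrow> \<theta> \<in> \<Theta> \<Longrightarrow> p \<theta> x > 0"
    and "t\<^sub>0 \<in> \<Theta>"
    and "\<And>t \<theta>. t \<in> \<Theta> \<Longrightarrow> \<theta> \<in> \<Theta> \<Longrightarrow>
           \<Phi>\<^sub>0 t \<theta> \<noteq> {} \<and> \<Phi>\<^sub>0 t \<theta> \<subseteq> dual_solutions X (P t) (P \<theta>)"
    and "\<And>\<theta> (t :: nat \<Rightarrow> real^'d).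
           \<theta> \<in> \<Theta> \<Longrightarrow> (\<And>n. t n \<in> \<Theta>) \<Longrightarrow> t \<longlonglongrightarrow> t\<^sub>0 \<Longrightarrow>
           \<exists>(\<phi> :: nat \<Rightarrow> real^'k \<Rightarrow> real) \<psi>.
             (\<forall>n. \<phi> n \<in> \<Phi>\<^sub>0 (t n) \<theta>) \<and> \<psi> \<in> \<Phi>\<^sub>0 t\<^sub>0 \<theta> \<and>
             (AE x in lebesgue. x \<in> X \<longrightarrow> (\<lambda>n. \<phi> n x - \<psi> x) \<longlonglongrightarrow> 0)"
    and "\<And>\<theta>. \<theta> \<in> \<Theta> \<Longrightarrow>
           \<exists>\<delta>>0. \<forall>i::'d.
             (\<integral>\<^sup>+x\<in>X. (SUP t\<in>param_ball \<Theta> \<delta> t\<^sub>0. SUP t'\<in>param_ball \<Theta> \<delta> t\<^sub>0. SUP \<phi>\<in>\<Phi>\<^sub>0 t \<theta>.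
                 ennreal \<bar>\<phi> x * partial_deriv i (\<lambda>v. p v x) t'\<bar>) \<partial>lebesgue) < \<infinity>"
  shows "\<forall>\<theta>\<in>\<Theta>.
           (\<lambda>t. W2_sq (P t) (P \<theta>)) differentiable (at t\<^sub>0) \<and>
           (\<forall>\<phi>\<in>\<Phi>\<^sub>0 t\<^sub>0 \<theta>.
              set_integrable lebesgue X (\<lambda>x. \<phi> x *\<^sub>R gradient (\<lambda>t. p t x) t\<^sub>0) \<and>
              (GDERIV (\<lambda>t. W2_sq (P t) (P \<theta>)) t\<^sub>0 :>
                 (LINT x:X|lebesgue. \<phi> x *\<^sub>R gradient (\<lambda>t. p t x) t\<^sub>0)))"
proof
  fix \<theta> assume \<theta>: "\<theta> \<in> \<Theta>"
  note W = assms(3) and dens = assms(4) and dual = assms(8)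
  define M where "M = lebesgue_on X"
  have X: "X \<in> sets lebesgue"
    using assms(1) by (rule convex_in_sets_lebesgue)
  have space_M: "space M = X"
    by (simp add: M_def space_restrict_space)
  obtain \<delta> where \<delta>: "0 < \<delta>"
    and \<delta>_fin: "\<And>i::'d. (\<integral>\<^sup>+x\<in>X. (SUP t\<in>param_ball \<Theta> \<delta> t\<^sub>0. SUP t'\<in>param_ball \<Theta> \<delta> t\<^sub>0. SUP \<phi>\<in>\<Phi>\<^sub>0 t \<theta>.
                 ennreal \<bar>\<phi> x * partial_deriv i (\<lambda>v. p v x) t'\<bar>) \<partial>lebesgue) < \<infinity>"
    using assms(10)[OF \<theta>] by blast
  obtain \<epsilon>\<^sub>0 where \<epsilon>\<^sub>0: "0 < \<epsilon>\<^sub>0" "cball t\<^sub>0 \<epsilon>\<^sub>0 \<subseteq> \<Theta>"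
    using assms(2,7) open_contains_cball by blast
  define \<epsilon> where "\<epsilon> = min \<delta> \<epsilon>\<^sub>0"
  have \<epsilon>: "0 < \<epsilon>" and ball_\<Theta>: "\<And>v. v \<in> cball t\<^sub>0 \<epsilon> \<Longrightarrow> v \<in> \<Theta>"
    using \<delta> \<epsilon>\<^sub>0 by (auto simp: \<epsilon>_def)
  have ball_param: "v \<in> param_ball \<Theta> \<delta> t\<^sub>0" if "v \<in> cball t\<^sub>0 \<epsilon>" for v
    using that ball_\<Theta>[OF that] by (auto simp: param_ball_def \<epsilon>_def dist_norm norm_minus_commute)
  have t0: "t\<^sub>0 \<in> cball t\<^sub>0 \<epsilon>"
    using \<epsilon> by simp
  interpret differentiable_family M p t\<^sub>0 \<epsilon>
  proof
    show "p v \<in> borel_measurable M" if "v \<in> cball t\<^sub>0 \<epsilon>" for v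
      using dens[OF ball_\<Theta>[OF that]] by (simp add: has_lebesgue_density_def M_def)
    show "(\<lambda>v. p v x) differentiable (at v)" if "v \<in> cball t\<^sub>0 \<epsilon>" "x \<in> space M" for v x
      using assms(5) that ball_\<Theta> by (simp add: space_M)
  qed fact
  define D where "D i x = (SUP t\<in>param_ball \<Theta> \<delta> t\<^sub>0. SUP t'\<in>param_ball \<Theta> \<delta> t\<^sub>0. SUP \<phi>\<in>\<Phi>\<^sub>0 t \<theta>.
                 ennreal \<bar>\<phi> x * partial_deriv i (\<lambda>v. p v x) t'\<bar>)" for i x
  have D: "(\<integral>\<^sup>+x. D i x \<partial>M) < \<infinity>" for i
    using \<delta>_fin[of i] X by (simp add: M_def D_def nn_integral_restrict_space)
  \<comment> \<open>The two suprema over the ball are independent: the potential may belong to one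
    parameter while the derivative is evaluated at another, as the mean value theorem
    requires.\<close>
  have bound: "ennreal \<bar>\<phi> x * dp i v x\<bar> \<le> D i x"
    if "t \<in> cball t\<^sub>0 \<epsilon>" "\<phi> \<in> \<Phi>\<^sub>0 t \<theta>" "v \<in> cball t\<^sub>0 \<epsilon>" for t \<phi> v i x
    unfolding D_def using that ball_param
    by (intro SUP_upper2[of t] SUP_upper2[of v] SUP_upper2[of \<phi>]) auto
  have \<Phi>_dual: "\<phi> \<in> dual_solutions X (P t) (P \<theta>)" if "t \<in> cball t\<^sub>0 \<epsilon>" "\<phi> \<in> \<Phi>\<^sub>0 t \<theta>" for t \<phi>
    using dual[OF ball_\<Theta>[OF that(1)] \<theta>] that(2) by blast
  have \<Phi>_meas: "\<phi> \<in> borel_measurable M" if "t \<in> cball t\<^sub>0 \<epsilon>" "\<phi> \<in> \<Phi>\<^sub>0 t \<theta>" for t \<phi>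
    unfolding M_def
  proof (rule measurable_trace_borel_lebesgue_on)
    show "sets (P t) = sets (restrict_space borel X)"
      using W[OF ball_\<Theta>[OF that(1)]] by (simp add: W2_space_def)
    show "\<phi> \<in> borel_measurable (P t)"
      using \<Phi>_dual[OF that] by (auto simp: dual_solutions_def)
  qed
  define F where "F t = W2_sq (P t) (P \<theta>)" for t
  have F_diff: "(\<integral>x. \<phi> x * (p s x - p t x) \<partial>M) \<le> F s - F t"
    if "s \<in> cball t\<^sub>0 \<epsilon>" "t \<in> cball t\<^sub>0 \<epsilon>" "\<phi> \<in> \<Phi>\<^sub>0 t \<theta>"
      "integrable M (\<lambda>x. \<phi> x * (p s x - p t x))" for s t \<phi>
    using that W2_sq_diff_ge[OF X W W W dens dens \<Phi>_dual] ball_\<Theta> \<theta> unfolding F_def M_def by blast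
  define G where "G \<phi> = (\<chi> i. \<integral>x. \<phi> x * dp i t\<^sub>0 x \<partial>M)" for \<phi>
  have G_inner: "h \<bullet> G \<phi> = (\<Sum>i\<in>UNIV. h $ i * (\<integral>x. \<phi> x * dp i t\<^sub>0 x \<partial>M))" for h \<phi>
    by (simp add: inner_vec_def G_def)
  \<comment> \<open>\<open>\<phi>\<close> is arbitrary and enters only the lower bound. The upper
    bound uses the limit potential of the sequence, possibly a different one; the squeeze still
    yields \<open>G \<phi>\<close>, so all potentials give the same gradient.\<close>
  have F_gderiv: "GDERIV F t\<^sub>0 :> G \<phi>" if \<phi>: "\<phi> \<in> \<Phi>\<^sub>0 t\<^sub>0 \<theta>" for \<phi>
  proof (rule gderiv_squeeze[OF \<epsilon>])
    fix t :: "nat \<Rightarrow> real^'d" assume t: "\<And>n. t n \<in> cball t\<^sub>0 \<epsilon> - {t\<^sub>0}" "t \<longlonglongrightarrow> t\<^sub>0"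
    have t_ball: "t n \<in> cball t\<^sub>0 \<epsilon>" and t_pos: "0 < norm (t n - t\<^sub>0)" for n
      using t(1)[of n] by auto
    define e where "e n = ((\<integral>x. \<phi> x * (p (t n) x - p t\<^sub>0 x) \<partial>M) - (t n - t\<^sub>0) \<bullet> G \<phi>) / norm (t n - t\<^sub>0)" for n
    \<comment> \<open>The constant sequence of potentials: only the densities vary here.\<close>
    note inc = increment_tendsto[where \<phi> = "\<lambda>_. \<phi>" and \<psi> = \<phi>, OF \<Phi>_meas[OF t0 \<phi>] \<Phi>_meas[OF t0 \<phi>]
        AE_I2[OF tendsto_const] t D bound[OF t0 \<phi>] bound[OF t0 \<phi>]]
    have "e \<longlonglongrightarrow> 0"
      using inc(2) unfolding e_def G_inner .
    then have "(\<lambda>n. - e n) \<longlonglongrightarrow> 0"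
      using tendsto_minus by fastforce
    moreover have "F (t n) - F t\<^sub>0 \<ge> (t n - t\<^sub>0) \<bullet> G \<phi> - (- e n) * norm (t n - t\<^sub>0)" for n
      using F_diff[OF t_ball t0 \<phi> inc(1)] t_pos[of n] unfolding e_def by simp
    ultimately show "\<exists>e. e \<longlonglongrightarrow> 0 \<and> (\<forall>n. F (t n) - F t\<^sub>0 \<ge> (t n - t\<^sub>0) \<bullet> G \<phi> - e n * norm (t n - t\<^sub>0))"
      by blast
  next
    fix t :: "nat \<Rightarrow> real^'d" assume t: "\<And>n. t n \<in> cball t\<^sub>0 \<epsilon> - {t\<^sub>0}" "t \<longlonglongrightarrow> t\<^sub>0"
    have t_ball: "t n \<in> cball t\<^sub>0 \<epsilon>" and t_pos: "0 < norm (t n - t\<^sub>0)" for n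
      using t(1)[of n] by auto
    obtain \<phi>' \<psi> where \<phi>': "\<And>n. \<phi>' n \<in> \<Phi>\<^sub>0 (t n) \<theta>" and \<psi>: "\<psi> \<in> \<Phi>\<^sub>0 t\<^sub>0 \<theta>"
      and conv: "AE x in lebesgue. x \<in> X \<longrightarrow> (\<lambda>n. \<phi>' n x - \<psi> x) \<longlonglongrightarrow> 0"
      using assms(9)[OF \<theta> ball_\<Theta>[OF t_ball] t(2)] by blast
    have lim: "AE x in M. (\<lambda>n. \<phi>' n x) \<longlonglongrightarrow> \<psi> x"
      using conv X unfolding M_def by (simp add: AE_restrict_space_iff LIM_zero_iff)
    note inc = increment_tendsto[where \<phi> = \<phi>', OF \<Phi>_meas[OF t_ball \<phi>'] \<Phi>_meas[OF t0 \<psi>]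
        lim t D bound[OF t_ball \<phi>'] bound[OF t0 \<psi>]]
    define e where "e n = ((\<integral>x. \<phi>' n x * (p (t n) x - p t\<^sub>0 x) \<partial>M) - (t n - t\<^sub>0) \<bullet> G \<psi>) / norm (t n - t\<^sub>0)" for n
    have "e \<longlonglongrightarrow> 0"
      using inc(2) unfolding e_def G_inner .
    moreover have "F (t n) - F t\<^sub>0 \<le> (t n - t\<^sub>0) \<bullet> G \<psi> + e n * norm (t n - t\<^sub>0)" for n
    proof -
      \<comment> \<open>The potential is now optimal at \<open>t n\<close>, so the subgradient
        inequality runs from \<open>t n\<close> to \<open>t\<^sub>0\<close>; reversing the sign
        turns it into an upper bound.\<close>
      have neg: "\<phi>' n x * (p t\<^sub>0 x - p (t n) x) = - (\<phi>' n x * (p (t n) x - p t\<^sub>0 x))" for x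
        by (simp add: algebra_simps)
      have "integrable M (\<lambda>x. \<phi>' n x * (p t\<^sub>0 x - p (t n) x))"
        unfolding neg using inc(1) by simp
      from F_diff[OF t0 t_ball \<phi>' this] have "F (t n) - F t\<^sub>0 \<le> (\<integral>x. \<phi>' n x * (p (t n) x - p t\<^sub>0 x) \<partial>M)"
        unfolding neg by simp
      then show ?thesis
        using t_pos[of n] unfolding e_def by simp
    qed
    ultimately show "\<exists>K e. e \<longlonglongrightarrow> 0 \<and> (\<forall>n. F (t n) - F t\<^sub>0 \<le> (t n - t\<^sub>0) \<bullet> K + e n * norm (t n - t\<^sub>0))"
      by blast
  qed
  \<comment> \<open>Expansion in the standard basis reduces the vector-valued integral to the
    coordinate integrals collected in \<open>G\<close>.\<close>
  have grad: "integrable M (\<lambda>x. \<phi> x *\<^sub>R gradient (\<lambda>t. p t x) t\<^sub>0)"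
    "(\<integral>x. \<phi> x *\<^sub>R gradient (\<lambda>t. p t x) t\<^sub>0 \<partial>M) = G \<phi>" if \<phi>: "\<phi> \<in> \<Phi>\<^sub>0 t\<^sub>0 \<theta>" for \<phi>
  proof -
    have int: "integrable M (\<lambda>x. \<phi> x * dp i t\<^sub>0 x)" for i
      using \<Phi>_meas[OF t0 \<phi>] measurable_partial_deriv bound[OF t0 \<phi> t0] D
      by (intro integrable_dominated_nn[where D = "D i"] borel_measurable_times) auto
    have "\<phi> x *\<^sub>R gradient (\<lambda>t. p t x) t\<^sub>0 = (\<Sum>i\<in>UNIV. (\<phi> x * dp i t\<^sub>0 x) *\<^sub>R axis i 1)" for x
      using basis_expansion[of "\<phi> x *\<^sub>R gradient (\<lambda>t. p t x) t\<^sub>0"]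
      by (simp add: gradient_def scalar_mult_eq_scaleR)
    moreover have "G \<phi> = (\<Sum>i\<in>UNIV. (\<integral>x. \<phi> x * dp i t\<^sub>0 x \<partial>M) *\<^sub>R axis i 1)"
      using basis_expansion[of "G \<phi>"] by (simp add: G_def scalar_mult_eq_scaleR)
    ultimately show "integrable M (\<lambda>x. \<phi> x *\<^sub>R gradient (\<lambda>t. p t x) t\<^sub>0)"
      "(\<integral>x. \<phi> x *\<^sub>R gradient (\<lambda>t. p t x) t\<^sub>0 \<partial>M) = G \<phi>"
      using int by simp_all
  qed
  obtain \<phi>\<^sub>0 where "\<phi>\<^sub>0 \<in> \<Phi>\<^sub>0 t\<^sub>0 \<theta>"
    using dual[OF assms(7) \<theta>] by blast
  then have "F differentiable (at t\<^sub>0)"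
    using F_gderiv unfolding gderiv_def differentiable_def by blast
  moreover have "set_integrable lebesgue X (\<lambda>x. \<phi> x *\<^sub>R gradient (\<lambda>t. p t x) t\<^sub>0) \<and>
      (GDERIV F t\<^sub>0 :> (LINT x:X|lebesgue. \<phi> x *\<^sub>R gradient (\<lambda>t. p t x) t\<^sub>0))"
    if "\<phi> \<in> \<Phi>\<^sub>0 t\<^sub>0 \<theta>" for \<phi>
    using grad[OF that] F_gderiv[OF that] X
    by (simp add: M_def set_integrable_def set_lebesgue_integral_def
        integrable_restrict_space integral_restrict_space)
  ultimately show "(\<lambda>t. W2_sq (P t) (P \<theta>)) differentiable (at t\<^sub>0) \<and>
           (\<forall>\<phi>\<in>\<Phi>\<^sub>0 t\<^sub>0 \<theta>.
              set_integrable lebesgue X (\<lambda>x. \<phi> x *\<^sub>R gradient (\<lambda>t. p t x) t\<^sub>0) \<and>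
              (GDERIV (\<lambda>t. W2_sq (P t) (P \<theta>)) t\<^sub>0 :>
                 (LINT x:X|lebesgue. \<phi> x *\<^sub>R gradient (\<lambda>t. p t x) t\<^sub>0)))"
    unfolding F_def by blast
qed

end
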